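(* For every two finite graphs $G$ and $H$ (each with at least one vertex) we have \[ i(G\times H)\le \max\{a(G),a(H)\}. \]
   Context: All graphs are finite, simple and undirected. For a graph $G$, $\alpha(G)$ is its independence number and $i(G)=\frac{\alpha(G)}{|V(G)|}$ is its independence ratio. For a set $U\subseteq V(G)$, $N_G(U)$ denotes the neighborhood of $U$ in $G$, i.e. the set of vertices adjacent to some vertex of $U$. Define \[ a(G)=\max\left\{\frac{|U|}{|U|+|N_G(U)|}\ :\ U \text{ a nonempty independent set of } G\right\}. \] The categorical (direct, tensor) product $G\times H$ has vertex set $V(G)\times V(H)$, and $\{(x_1,y_1),(x_2,y_2)\}$ is an edge iff $\{x_1,x_2\}\in E(G)$ and $\{y_1,y_2\}\in E(H)$. *)

theory Defs
  imports Complex_Main "Graph_Theory.Pair_Digraph"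
begin

text \<open>
  A finite simple undirected graph is a digraph satisfying \<^locale>\<open>pair_graph\<close>: finite vertex set,
  no loops, symmetric arc relation. The edge between x and y is represented by the two
  arcs (x, y) and (y, x).
\<close>

definition independent_set :: "'a pair_pre_digraph \<Rightarrow> 'a set \<Rightarrow> bool" where
  "independent_set G U \<longleftrightarrow> U \<subseteq> pverts G \<and> (\<forall>x\<in>U. \<forall>y\<in>U. (x, y) \<notin> parcs G)"

definition nbhd :: "'a pair_pre_digraph \<Rightarrow> 'a set \<Rightarrow> 'a set" where
  "nbhd G U = {v \<in> pverts G. \<exists>u\<in>U. (u, v) \<in> parcs G}"

definition independence_number :: "'a pair_pre_digraph \<Rightarrow> nat" where
  "independence_number G = Max {card U | U. independent_set G U}"

definition independence_ratio :: "'a pair_pre_digraph \<Rightarrow> real" where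
  "independence_ratio G = real (independence_number G) / real (card (pverts G))"

definition a_ratio :: "'a pair_pre_digraph \<Rightarrow> real" where
  "a_ratio G = Max {real (card U) / (real (card U) + real (card (nbhd G U))) | U.
      independent_set G U \<and> U \<noteq> {}}"

definition cat_prod :: "'a pair_pre_digraph \<Rightarrow> 'b pair_pre_digraph \<Rightarrow> ('a \<times> 'b) pair_pre_digraph" where
  "cat_prod G H = \<lparr> pverts = pverts G \<times> pverts H,
     parcs = {((x1, y1), (x2, y2)) | x1 y1 x2 y2. (x1, x2) \<in> parcs G \<and> (y1, y2) \<in> parcs H} \<rparr>"

lemma cat_prod_simps [simp]:
  "pverts (cat_prod G H) = pverts G \<times> pverts H"
  "((x1, y1), (x2, y2)) \<in> parcs (cat_prod G H) \<longleftrightarrow> (x1, x2) \<in> parcs G \<and> (y1, y2) \<in> parcs H"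
  by (auto simp: cat_prod_def)

lemma pair_graph_cat_prod:
  assumes "pair_graph G" "pair_graph H"
  shows "pair_graph (cat_prod G H)"
proof -
  interpret G: pair_graph G by fact
  interpret H: pair_graph H by fact
  have sub: "parcs (cat_prod G H) \<subseteq> (pverts G \<times> pverts H) \<times> (pverts G \<times> pverts H)"
    by (auto dest: G.wellformed' H.wellformed')
  have sG: "(y, x) \<in> parcs G" if "(x, y) \<in> parcs G" for x y
    using that G.pair_sym_arcs by (auto simp: symmetric_def elim: symE)
  have sH: "(y, x) \<in> parcs H" if "(x, y) \<in> parcs H" for x y
    using that H.pair_sym_arcs by (auto simp: symmetric_def elim: symE)
  show ?thesis
  proof
    show "finite (pverts (cat_prod G H))"
      using G.pair_finite_verts H.pair_finite_verts by simp
    then show "finite (parcs (cat_prod G H))"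
      by (intro finite_subset[OF sub]) simp
    show "symmetric (with_proj (cat_prod G H))"
      using sG sH by (auto simp: symmetric_def intro!: symI)
  qed (use sub G.no_loops' in \<open>auto dest: G.no_loops'\<close>)
qed

text \<open>The maxima above range over finite nonempty sets.\<close>

lemma finite_independent_sets:
  assumes "finite (pverts G)"
  shows "finite {U. independent_set G U}"
  by (rule finite_subset[of _ "Pow (pverts G)"]) (use assms in \<open>auto simp: independent_set_def\<close>)

lemma independence_number_range:
  assumes "finite (pverts G)"
  shows "finite {card U | U. independent_set G U}" "{card U | U. independent_set G U} \<noteq> {}"
proof -
  show "finite {card U | U. independent_set G U}"
    using finite_independent_sets[OF assms] by simp
  have "independent_set G {}" by (simp add: independent_set_def)
  then show "{card U | U. independent_set G U} \<noteq> {}" by blast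
qed

lemma a_ratio_range:
  assumes "pair_graph G" "pverts G \<noteq> {}"
  shows "finite {real (card U) / (real (card U) + real (card (nbhd G U))) | U.
           independent_set G U \<and> U \<noteq> {}}"
    and "{real (card U) / (real (card U) + real (card (nbhd G U))) | U.
           independent_set G U \<and> U \<noteq> {}} \<noteq> {}"
proof -
  interpret pair_graph G by fact
  have "finite {U. independent_set G U \<and> U \<noteq> {}}"
    using finite_independent_sets[OF pair_finite_verts] by (rule rev_finite_subset) auto
  then show "finite {real (card U) / (real (card U) + real (card (nbhd G U))) | U.
           independent_set G U \<and> U \<noteq> {}}" by simp
  from assms(2) obtain v where "v \<in> pverts G" by blast
  then have "independent_set G {v}" by (auto simp: independent_set_def dest: no_loops')
  then show "{real (card U) / (real (card U) + real (card (nbhd G U))) | U.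
           independent_set G U \<and> U \<noteq> {}} \<noteq> {}" by blast
qed

end

theory Submission
  imports Defs
begin

text \<open>
  Let \<open>S\<close> be independent in the product. Split every slice \<open>{x. (x, y) \<in> S}\<close> into the vertices
  that are isolated in the subgraph of \<open>G\<close> induced by the slice and the remaining ones. The isolated
  parts \<open>I y\<close> are independent in \<open>G\<close>; collecting the remaining points of \<open>S\<close> along the other
  coordinate gives sets \<open>J x\<close>, which are independent in \<open>H\<close>. The points lying over the
  neighbourhoods of the \<open>I y\<close> and those lying over the neighbourhoods of the \<open>J x\<close> are disjoint
  from \<open>S\<close> and from each other, so that summing \<open>|U| \<le> a (|U| + |N(U)|)\<close> over all \<open>I y\<close> and
  \<open>J x\<close> yields \<open>|S| \<le> a |V(G)| |V(H)|\<close>.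
\<close>

lemma pair_graph_arc_sym:
  assumes "pair_graph G" "(x, y) \<in> parcs G"
  shows "(y, x) \<in> parcs G"
proof -
  interpret pair_graph G by fact
  show ?thesis
    using assms(2) pair_sym_arcs by (auto simp: symmetric_def elim: symE)
qed

text \<open>Clearing the denominator in the maximum makes the bound valid also for
  \<open>U = {}\<close>, where both sides are 0; slices may be empty.\<close>

lemma card_independent_le_a_ratio:
  assumes "pair_graph G" "independent_set G U"
  shows "real (card U) \<le> a_ratio G * (real (card U) + real (card (nbhd G U)))"
proof (cases "U = {}")
  case True
  then show ?thesis by (simp add: nbhd_def)
next
  case False
  interpret pair_graph G by fact
  have sub: "U \<subseteq> pverts G" using assms(2) by (simp add: independent_set_def)
  with False have "pverts G \<noteq> {}" by blast
  then have "real (card U) / (real (card U) + real (card (nbhd G U))) \<le> a_ratio G"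
    unfolding a_ratio_def using a_ratio_range[OF assms(1)] assms(2) False
    by (intro Max_ge) auto
  moreover have "card U > 0"
    using False finite_subset[OF sub pair_finite_verts] by (simp add: card_gt_0_iff)
  ultimately show ?thesis
    by (simp add: divide_le_eq add_pos_nonneg)
qed

lemma a_ratio_nonneg:
  assumes "pair_graph G" "pverts G \<noteq> {}"
  shows "a_ratio G \<ge> 0"
proof -
  have "a_ratio G \<in> {real (card U) / (real (card U) + real (card (nbhd G U))) | U.
      independent_set G U \<and> U \<noteq> {}}"
    unfolding a_ratio_def using a_ratio_range[OF assms] by (rule Max_in)
  then show ?thesis by auto
qed

lemma card_independent_cat_prod_le:
  assumes G: "pair_graph G" and H: "pair_graph H"
    and a: "a_ratio G \<le> a" "a_ratio H \<le> a" "0 \<le> a"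
    and S: "independent_set (cat_prod G H) S"
  shows "real (card S) \<le> a * real (card (pverts G \<times> pverts H))"
proof -
  interpret G: pair_graph G by fact
  interpret H: pair_graph H by fact
  note symG = pair_graph_arc_sym[OF G] and symH = pair_graph_arc_sym[OF H]
  define I where "I y = {x. (x, y) \<in> S \<and> (\<forall>x'. (x', y) \<in> S \<longrightarrow> (x, x') \<notin> parcs G)}" for y
  define J where "J x = {y. (x, y) \<in> S \<and> (\<exists>x'. (x', y) \<in> S \<and> (x, x') \<in> parcs G)}" for x
  have SV: "S \<subseteq> pverts G \<times> pverts H"
    using S by (simp add: independent_set_def)
  have S_arc: False
    if "(x, y) \<in> S" "(x', y') \<in> S" "(x, x') \<in> parcs G" "(y, y') \<in> parcs H" for x y x' y'
    using S that unfolding independent_set_def by (metis cat_prod_simps(2))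
  have indI: "independent_set G (I y)" for y
    using SV by (auto simp: independent_set_def I_def)
  \<comment> \<open>If \<open>y\<close> and \<open>y'\<close> in \<open>J x\<close> were adjacent,
    the witness \<open>x'\<close> for \<open>y'\<close> would make \<open>(x, y)\<close> and
    \<open>(x', y')\<close> adjacent points of \<open>S\<close>.\<close>
  have indJ: "independent_set H (J x)" for x
    using SV S_arc symG unfolding independent_set_def J_def by blast
  have fin: "finite (I y)" "finite (J x)" "finite (nbhd G (I y))" "finite (nbhd H (J x))" for x y
    using indI[of y] indJ[of x] G.pair_finite_verts H.pair_finite_verts
    by (auto simp: independent_set_def nbhd_def intro: finite_subset)

  \<comment> \<open>\<open>I\<close> is indexed by the second coordinate, so
    \<open>prod.swap\<close> puts the \<open>G\<close>-coordinate back in front.\<close>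
  define SI SJ P Q where
    "SI = prod.swap ` Sigma (pverts H) I" and "SJ = Sigma (pverts G) J" and
    "P = prod.swap ` Sigma (pverts H) (\<lambda>y. nbhd G (I y))" and
    "Q = Sigma (pverts G) (\<lambda>x. nbhd H (J x))"
  note sets = SI_def SJ_def P_def Q_def
  have finS: "finite SI" "finite SJ" "finite P" "finite Q"
    using fin G.pair_finite_verts H.pair_finite_verts by (auto simp: sets)
  have memI: "(x, y) \<in> SI \<longleftrightarrow> y \<in> pverts H \<and> x \<in> I y" for x y
    by (force simp: SI_def)
  have memP: "(x, y) \<in> P \<longleftrightarrow> y \<in> pverts H \<and> x \<in> nbhd G (I y)" for x y
    by (force simp: P_def)
  have S_eq: "S = SI \<union> SJ"
    using SV by (auto simp: memI SJ_def I_def J_def)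
  have "SI \<inter> SJ = {}"
    by (auto simp: memI SJ_def I_def J_def)
  \<comment> \<open>A point of \<open>S\<close> over a neighbour of \<open>u\<close> in
    \<open>I y\<close> would contradict that \<open>u\<close> is isolated in its slice.\<close>
  moreover have "S \<inter> P = {}"
    by (auto simp: memP I_def nbhd_def)
  \<comment> \<open>If \<open>y\<close> is adjacent to \<open>y'\<close> in \<open>J x\<close>, then
    \<open>(x, y)\<close> is adjacent to the point \<open>(x', y')\<close> of \<open>S\<close>, with
    \<open>x'\<close> the witness for \<open>y'\<close>.\<close>
  moreover have "S \<inter> Q = {}"
    using S_arc symG symH by (fastforce simp: Q_def J_def nbhd_def)
  \<comment> \<open>A common point \<open>(x, y)\<close> has a neighbour \<open>u\<close> of
    \<open>x\<close> in \<open>I y\<close> and a neighbour \<open>v\<close> of \<open>y\<close> in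
    \<open>J x\<close>; then \<open>(u, y)\<close> and \<open>(x, v)\<close> are adjacent points of
    \<open>S\<close>.\<close>
  moreover have "P \<inter> Q = {}"
    using S_arc symH by (fastforce simp: memP Q_def I_def J_def nbhd_def)
  ultimately have "card (S \<union> (P \<union> Q)) = card SI + card SJ + (card P + card Q)"
    using finS by (simp add: S_eq card_Un_disjoint Int_Un_distrib Int_Un_distrib2)
  moreover have "S \<union> (P \<union> Q) \<subseteq> pverts G \<times> pverts H"
    using SV by (auto simp: memP Q_def nbhd_def)
  ultimately have total: "card SI + card P + (card SJ + card Q) \<le> card (pverts G \<times> pverts H)"
    using card_mono[of "pverts G \<times> pverts H" "S \<union> (P \<union> Q)"]
      G.pair_finite_verts H.pair_finite_verts by simp

  have cards:
    "card SI = (\<Sum>y\<in>pverts H. card (I y))" "card P = (\<Sum>y\<in>pverts H. card (nbhd G (I y)))"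
    "card SJ = (\<Sum>x\<in>pverts G. card (J x))" "card Q = (\<Sum>x\<in>pverts G. card (nbhd H (J x)))"
    using fin G.pair_finite_verts H.pair_finite_verts by (simp_all add: sets card_image)
  have "real (card (I y)) \<le> a * (real (card (I y)) + real (card (nbhd G (I y))))" for y
    using card_independent_le_a_ratio[OF G indI[of y]] mult_right_mono[OF a(1)]
    by (rule order_trans) simp
  then have *: "real (card SI) \<le> a * real (card SI + card P)"
    by (simp add: cards sum_distrib_left flip: sum.distrib) (intro sum_mono)
  have "real (card (J x)) \<le> a * (real (card (J x)) + real (card (nbhd H (J x))))" for x
    using card_independent_le_a_ratio[OF H indJ[of x]] mult_right_mono[OF a(2)]
    by (rule order_trans) simp
  then have **: "real (card SJ) \<le> a * real (card SJ + card Q)"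
    by (simp add: cards sum_distrib_left flip: sum.distrib) (intro sum_mono)
  have "card S = card SI + card SJ"
    unfolding S_eq using finS \<open>SI \<inter> SJ = {}\<close> by (simp add: card_Un_disjoint)
  then have "real (card S) \<le> a * real (card SI + card P + (card SJ + card Q))"
    using * ** by (simp add: distrib_left)
  \<comment> \<open>The four sets need not cover the product, so this step relies on
    \<open>0 \<le> a\<close>.\<close>
  also have "\<dots> \<le> a * real (card (pverts G \<times> pverts H))"
    using total a(3) by (intro mult_left_mono of_nat_mono)
  finally show ?thesis .
qed

theorem theorem3p1:
  fixes G :: "'a pair_pre_digraph" and H :: "'b pair_pre_digraph"
  assumes "pair_graph G" and "pair_graph H"
    and "pverts G \<noteq> {}" and "pverts H \<noteq> {}"
  shows "independence_ratio (cat_prod G H) \<le> max (a_ratio G) (a_ratio H)"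
proof -
  interpret GH: pair_graph "cat_prod G H"
    by (rule pair_graph_cat_prod) fact+
  have "independence_number (cat_prod G H) \<in> {card U | U. independent_set (cat_prod G H) U}"
    unfolding independence_number_def
    using independence_number_range[OF GH.pair_finite_verts] by (rule Max_in)
  then obtain S where S: "independent_set (cat_prod G H) S"
    "independence_number (cat_prod G H) = card S" by blast
  have "real (card S) \<le> max (a_ratio G) (a_ratio H) * real (card (pverts G \<times> pverts H))"
    using a_ratio_nonneg[OF assms(1,3)]
    by (intro card_independent_cat_prod_le[OF assms(1,2) _ _ _ S(1)]) auto
  moreover have "card (pverts G \<times> pverts H) > 0"
    using GH.pair_finite_verts assms(3,4) by (simp only: card_gt_0_iff cat_prod_simps) simp
  ultimately show ?thesis
    unfolding independence_ratio_def S(2) cat_prod_simps by (simp only: divide_le_eq of_nat_0_less_iff if_True)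
qed

end
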